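(* Let $I=(P,F,G,W)$ be an instance of Seat Arrangement with symmetric preferences and W-utility. Then an exchange-stable arrangement always exists. Moreover, starting from any arrangement and repeatedly swapping the seats of the two agents of some exchange-blocking pair (as long as one exists), the process terminates after finitely many swaps in an exchange-stable arrangement.
   Context: An instance $I=(P,F,G,U)$ of Seat Arrangement consists of a finite set $P$ of agents; for each $p\in P$ a valuation function $f_p:P\setminus\{p\}\to\mathbb{R}$; an undirected simple graph $G$ (the seat graph) with $|V(G)|=|P|$; and a utility type $U\in\{B,S,W\}$. An arrangement is a bijection $\sigma:P\to V(G)$. Writing $N(\sigma(p))$ for the set of neighbours of $\sigma(p)$ in $G$, the utility of $p$ under $\sigma$ is $u_\sigma(p)=\min_{v\in N(\sigma(p))} f_p(\sigma^{-1}(v))$ for W-utility (and $u_\sigma(p)=0$ if $\sigma(p)$ has no neighbours). For distinct $p,q\in P$, $\sigma^{p\leftrightarrow q}$ denotes the arrangement equal to $\sigma$ except that $p$ is seated at $\sigma(q)$ and $q$ at $\sigma(p)$. Agent $p$ envies $q$ under $\sigma$ if $u_\sigma(p)<u_{\sigma^{p\leftrightarrow q}}(p)$. A pair $\{p,q\}$ is exchange-blocking if $p$ envies $q$ and $q$ envies $p$; $\sigma$ is exchange-stable if no exchange-blocking pair exists. Preferences are symmetric if $f_p(q)=f_q(p)$ for all distinct $p,q\in P$. *)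

theory Defs
  imports Complex_Main
begin

datatype utility_type = B_utility | S_utility | W_utility

text \<open>
  An instance (P, F, G, U). The seat graph G has vertex set \<open>seats\<close> and undirected edges given as
  two-element sets. The valuation \<open>valuation I p q\<close> is meaningful only for distinct agents p and q;
  its other values are never used.
\<close>

record ('a, 'v) seat_instance =
  agents :: "'a set"
  valuation :: "'a \<Rightarrow> 'a \<Rightarrow> real"
  seats :: "'v set"
  seat_edges :: "'v set set"
  util_type :: utility_type

definition seat_arrangement_instance :: "('a, 'v) seat_instance \<Rightarrow> bool" where
  "seat_arrangement_instance I \<longleftrightarrow>
     finite (agents I) \<and> finite (seats I) \<and> card (seats I) = card (agents I) \<and>
     seat_edges I \<subseteq> {e. e \<subseteq> seats I \<and> card e = 2}"

definition symmetric_preferences :: "('a, 'v) seat_instance \<Rightarrow> bool" where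
  "symmetric_preferences I \<longleftrightarrow>
     (\<forall>p\<in>agents I. \<forall>q\<in>agents I. p \<noteq> q \<longrightarrow> valuation I p q = valuation I q p)"

definition neighbours :: "('a, 'v) seat_instance \<Rightarrow> 'v \<Rightarrow> 'v set" where
  "neighbours I v = {w \<in> seats I. {v, w} \<in> seat_edges I}"

definition arrangement :: "('a, 'v) seat_instance \<Rightarrow> ('a \<Rightarrow> 'v) \<Rightarrow> bool" where
  "arrangement I \<sigma> \<longleftrightarrow> bij_betw \<sigma> (agents I) (seats I)"

text \<open>
  Best, sum and worst value over the agents in neighbouring seats; an agent without
  neighbours has utility 0.
\<close>

definition utility :: "('a, 'v) seat_instance \<Rightarrow> ('a \<Rightarrow> 'v) \<Rightarrow> 'a \<Rightarrow> real" where
  "utility I \<sigma> p =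
     (let N = neighbours I (\<sigma> p); g = (\<lambda>v. valuation I p (inv_into (agents I) \<sigma> v)) in
      if N = {} then 0
      else case util_type I of
             B_utility \<Rightarrow> Max (g ` N)
           | S_utility \<Rightarrow> (\<Sum>v\<in>N. g v)
           | W_utility \<Rightarrow> Min (g ` N))"

definition swap_seats :: "('a \<Rightarrow> 'v) \<Rightarrow> 'a \<Rightarrow> 'a \<Rightarrow> ('a \<Rightarrow> 'v)" where
  "swap_seats \<sigma> p q = \<sigma>(p := \<sigma> q, q := \<sigma> p)"

definition envies :: "('a, 'v) seat_instance \<Rightarrow> ('a \<Rightarrow> 'v) \<Rightarrow> 'a \<Rightarrow> 'a \<Rightarrow> bool" where
  "envies I \<sigma> p q \<longleftrightarrow> utility I \<sigma> p < utility I (swap_seats \<sigma> p q) p"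

definition exchange_blocking :: "('a, 'v) seat_instance \<Rightarrow> ('a \<Rightarrow> 'v) \<Rightarrow> 'a \<Rightarrow> 'a \<Rightarrow> bool" where
  "exchange_blocking I \<sigma> p q \<longleftrightarrow>
     p \<in> agents I \<and> q \<in> agents I \<and> p \<noteq> q \<and> envies I \<sigma> p q \<and> envies I \<sigma> q p"

definition exchange_stable :: "('a, 'v) seat_instance \<Rightarrow> ('a \<Rightarrow> 'v) \<Rightarrow> bool" where
  "exchange_stable I \<sigma> \<longleftrightarrow> \<not> (\<exists>p q. exchange_blocking I \<sigma> p q)"

definition swap_step :: "('a, 'v) seat_instance \<Rightarrow> ('a \<Rightarrow> 'v) \<Rightarrow> ('a \<Rightarrow> 'v) \<Rightarrow> bool" where
  "swap_step I \<sigma> \<tau> \<longleftrightarrow> (\<exists>p q. exchange_blocking I \<sigma> p q \<and> \<tau> = swap_seats \<sigma> p q)"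

end

theory Submission
  imports Defs
begin

text \<open>
  Swapping a blocking pair changes the weights only of the edges at the two exchanged seats.
  Each of these edges ends up heavier than the lightest of them was before: after the swap, all
  edges at the new seat of an agent are worth more to that agent than the minimum at the old seat
  (if the old seat is isolated, the other agent's utility rises to 0 by taking it, so some edge had
  negative weight while all new weights are positive). Hence weighting each edge by a sufficiently
  large base, raised to the number of possible valuations exceeding its weight, gives a natural
  number that drops in every swap.
\<close>

section \<open>Power sums over ranks in a finite linear order\<close>

text \<open>Let \<open>m\<close> be the minimum of \<open>W\<close> on \<open>A\<close>. By
  \<open>improve\<close>, every new value on \<open>A\<close> exceeds \<open>m\<close>, so its rank
  (the number of larger values in \<open>V\<close>) is below that of \<open>m\<close>. Even
  \<open>card S\<close> terms with a smaller exponent cannot reach the single old term contributed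
  by \<open>m\<close>.\<close>

lemma rank_power_sum_less:
  fixes W W' :: "'b \<Rightarrow> 'c::linorder"
  assumes "finite S" "finite V" "A \<subseteq> S" "A \<noteq> {}"
    and W: "W ` S \<subseteq> V" and W': "W' ` S \<subseteq> V"
    and same: "\<And>z. z \<in> S - A \<Longrightarrow> W' z = W z"
    and improve: "\<And>z. z \<in> A \<Longrightarrow> \<exists>z'\<in>A. W z' < W' z"
  shows "(\<Sum>z\<in>S. Suc (card S) ^ card {x \<in> V. W' z < x}) <
         (\<Sum>z\<in>S. Suc (card S) ^ card {x \<in> V. W z < x})"
proof -
  let ?B = "Suc (card S)"
  let ?r = "\<lambda>y. card {x \<in> V. y < x}"
  have finA: "finite A"
    using assms finite_subset by blast
  define m where "m = Min (W ` A)"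
  have "m \<in> W ` A"
    unfolding m_def using finA \<open>A \<noteq> {}\<close> by (intro Min_in) auto
  then obtain z0 where z0: "z0 \<in> A" "m = W z0" by blast
  have gt: "m < W' z" if "z \<in> A" for z
  proof -
    obtain z' where z': "z' \<in> A" "W z' < W' z"
      using improve[OF \<open>z \<in> A\<close>] by blast
    moreover have "m \<le> W z'"
      using z' finA unfolding m_def by auto
    ultimately show ?thesis by simp
  qed
  have r_less: "?r (W' z) < ?r m" if "z \<in> A" for z
  proof (rule psubset_card_mono)
    show "finite {x \<in> V. m < x}" using \<open>finite V\<close> by simp
    \<comment> \<open>Strictness of the inclusion: \<open>W' z\<close> itself is counted in the rank
      of \<open>m\<close> but not in its own rank.\<close>
    have "W' z \<in> V" using W' that \<open>A \<subseteq> S\<close> by auto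
    then show "{x \<in> V. W' z < x} \<subset> {x \<in> V. m < x}"
      using gt[OF that] by (auto dest: less_trans)
  qed
  \<comment> \<open>Positivity makes the truncated difference \<open>?r m - 1\<close> a true
    predecessor, so the factor \<open>?B\<close> can be absorbed into the power below.\<close>
  then have pos: "0 < ?r m" using z0(1) by force
  have "(\<Sum>z\<in>A. ?B ^ ?r (W' z)) \<le> (\<Sum>z\<in>A. ?B ^ (?r m - 1))"
    using r_less by (intro sum_mono power_increasing) fastforce+
  also have "\<dots> = card A * ?B ^ (?r m - 1)" by simp
  \<comment> \<open>The successor in the base \<open>?B\<close> makes this strict:
    \<open>card A\<close> is at most \<open>card S\<close>.\<close>
  also have "\<dots> < ?B * ?B ^ (?r m - 1)"
    using card_mono[OF \<open>finite S\<close> \<open>A \<subseteq> S\<close>] by (intro mult_strict_right_mono) auto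
  also have "\<dots> = ?B ^ ?r m"
    using pos by (metis Suc_diff_1 power_Suc)
  also have "\<dots> \<le> (\<Sum>z\<in>A. ?B ^ ?r (W z))"
    using z0 finA member_le_sum[of z0 A "\<lambda>z. ?B ^ ?r (W z)"] by auto
  finally have "(\<Sum>z\<in>A. ?B ^ ?r (W' z)) < (\<Sum>z\<in>A. ?B ^ ?r (W z))" .
  moreover have "(\<Sum>z\<in>S - A. ?B ^ ?r (W' z)) = (\<Sum>z\<in>S - A. ?B ^ ?r (W z))"
    using same by simp
  ultimately show ?thesis
    by (simp add: sum.subset_diff[OF \<open>A \<subseteq> S\<close> \<open>finite S\<close>])
qed

section \<open>Seat swaps\<close>

lemma swap_seats_commute: "swap_seats \<sigma> p q = swap_seats \<sigma> q p"
  by (auto simp: swap_seats_def fun_eq_iff)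

lemma exchange_blocking_commute: "exchange_blocking I \<sigma> p q \<longleftrightarrow> exchange_blocking I \<sigma> q p"
  by (auto simp: exchange_blocking_def envies_def swap_seats_commute[of \<sigma> p q])

lemma arrangement_swap_seats:
  assumes "arrangement I \<sigma>" "p \<in> agents I" "q \<in> agents I"
  shows "arrangement I (swap_seats \<sigma> p q)"
proof -
  have inj: "inj_on \<sigma> (agents I)" and img: "\<sigma> ` agents I = seats I"
    using assms(1) by (auto simp: arrangement_def bij_betw_def)
  have "inj_on (swap_seats \<sigma> p q) (agents I)"
    using inj assms(2,3) by (auto simp: inj_on_def swap_seats_def)
  moreover have "swap_seats \<sigma> p q ` agents I = \<sigma> ` agents I"
    using assms(2,3) by (auto simp: swap_seats_def fun_upd_image)
  ultimately show ?thesis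
    using img by (simp add: arrangement_def bij_betw_def)
qed

section \<open>Edge weights and the potential\<close>

text \<open>Each undirected edge appears in both orientations, so that an edge weight can be read
  from the viewpoint of the agent in the first seat.\<close>

definition seat_adjacency :: "('a, 'v) seat_instance \<Rightarrow> ('v \<times> 'v) set" where
  "seat_adjacency I = Sigma (seats I) (neighbours I)"

definition edge_value :: "('a, 'v) seat_instance \<Rightarrow> ('a \<Rightarrow> 'v) \<Rightarrow> 'v \<times> 'v \<Rightarrow> real" where
  "edge_value I \<sigma> = (\<lambda>(v, w).
     valuation I (inv_into (agents I) \<sigma> v) (inv_into (agents I) \<sigma> w))"

text \<open>The set \<open>V\<close> does not depend on the arrangement, so ranks before and after a
  swap are measured on the same scale.\<close>

definition potential :: "('a, 'v) seat_instance \<Rightarrow> ('a \<Rightarrow> 'v) \<Rightarrow> nat" where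
  "potential I \<sigma> =
     (let V = case_prod (valuation I) ` (agents I \<times> agents I) in
      \<Sum>e\<in>seat_adjacency I. Suc (card (seat_adjacency I)) ^ card {x \<in> V. edge_value I \<sigma> e < x})"

context
  fixes I :: "('a, 'v) seat_instance"
  assumes inst: "seat_arrangement_instance I"
    and symm: "symmetric_preferences I"
    and worst: "util_type I = W_utility"
begin

lemma finite_neighbours: "finite (neighbours I v)"
  using inst by (auto simp: seat_arrangement_instance_def neighbours_def)

lemma seat_adjacency_sym: "(v, w) \<in> seat_adjacency I \<Longrightarrow> (w, v) \<in> seat_adjacency I"
  by (auto simp: seat_adjacency_def neighbours_def insert_commute)

lemma seat_adjacency_irrefl: "(v, w) \<in> seat_adjacency I \<Longrightarrow> v \<noteq> w"
  using inst by (auto simp: seat_adjacency_def neighbours_def seat_arrangement_instance_def)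

lemma finite_seat_adjacency: "finite (seat_adjacency I)"
  using inst finite_neighbours by (auto simp: seat_adjacency_def seat_arrangement_instance_def)

lemma agent_of_seat:
  assumes "arrangement I \<sigma>" "v \<in> seats I"
  shows "inv_into (agents I) \<sigma> v \<in> agents I" "\<sigma> (inv_into (agents I) \<sigma> v) = v"
  using assms unfolding arrangement_def bij_betw_def
  by (auto simp: inv_into_into f_inv_into_f)

lemma seat_of_agent:
  assumes "arrangement I \<sigma>" "p \<in> agents I"
  shows "inv_into (agents I) \<sigma> (\<sigma> p) = p" "\<sigma> p \<in> seats I"
  using assms unfolding arrangement_def bij_betw_def by auto

lemma edge_value_in_valuations:
  assumes "arrangement I \<sigma>" "e \<in> seat_adjacency I"
  shows "edge_value I \<sigma> e \<in> case_prod (valuation I) ` (agents I \<times> agents I)"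
  using assms agent_of_seat[OF assms(1)]
  by (force simp: edge_value_def seat_adjacency_def neighbours_def)

text \<open>Symmetry of preferences enters here. It is assumed for distinct agents only, hence the
  detour: the ends of an edge are distinct seats and therefore hold distinct agents.\<close>

lemma edge_value_sym:
  assumes "arrangement I \<sigma>" "(v, w) \<in> seat_adjacency I"
  shows "edge_value I \<sigma> (v, w) = edge_value I \<sigma> (w, v)"
proof -
  have vw: "v \<in> seats I" "w \<in> seats I" "v \<noteq> w"
    using assms seat_adjacency_irrefl by (auto simp: seat_adjacency_def neighbours_def)
  then have "inv_into (agents I) \<sigma> v \<noteq> inv_into (agents I) \<sigma> w"
    using agent_of_seat(2)[OF assms(1)] by metis
  then show ?thesis
    using symm agent_of_seat(1)[OF assms(1)] vw
    by (simp add: edge_value_def symmetric_preferences_def)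
qed

section \<open>W-utility as a minimum of edge weights\<close>

lemma utility_isolated: "neighbours I (\<sigma> p) = {} \<Longrightarrow> utility I \<sigma> p = 0"
  by (simp add: utility_def)

lemma utility_eq_Min:
  assumes "arrangement I \<sigma>" "p \<in> agents I" "neighbours I (\<sigma> p) \<noteq> {}"
  shows "utility I \<sigma> p = Min ((\<lambda>w. edge_value I \<sigma> (\<sigma> p, w)) ` neighbours I (\<sigma> p))"
  using assms(3) by (simp add: utility_def worst edge_value_def seat_of_agent[OF assms(1,2)])

lemma utility_le:
  assumes "arrangement I \<sigma>" "p \<in> agents I" "w \<in> neighbours I (\<sigma> p)"
  shows "utility I \<sigma> p \<le> edge_value I \<sigma> (\<sigma> p, w)"
proof -
  have "neighbours I (\<sigma> p) \<noteq> {}" using assms(3) by blast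
  from utility_eq_Min[OF assms(1,2) this] show ?thesis
    using assms(3) finite_neighbours by simp
qed

lemma utility_attained:
  assumes "arrangement I \<sigma>" "p \<in> agents I" "neighbours I (\<sigma> p) \<noteq> {}"
  obtains w where "w \<in> neighbours I (\<sigma> p)" "utility I \<sigma> p = edge_value I \<sigma> (\<sigma> p, w)"
proof -
  have "utility I \<sigma> p \<in> (\<lambda>w. edge_value I \<sigma> (\<sigma> p, w)) ` neighbours I (\<sigma> p)"
    unfolding utility_eq_Min[OF assms] using assms(3) finite_neighbours by (intro Min_in) auto
  then show ?thesis using that by blast
qed

section \<open>Decrease of the potential under a swap\<close>

text \<open>After the swap \<open>q\<close> sits at \<open>\<sigma> p\<close>, so every edge there
  is worth at least the new utility of \<open>q\<close>, which exceeds the old one. It remains to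
  find an old edge at one of the two seats whose weight is at most the old utility of
  \<open>q\<close>.\<close>

lemma swapped_edge_improves:
  assumes arr: "arrangement I \<sigma>" and bl: "exchange_blocking I \<sigma> p q"
    and w: "w \<in> neighbours I (\<sigma> p)"
  shows "\<exists>v\<in>{\<sigma> p, \<sigma> q}. \<exists>w'\<in>neighbours I v.
           edge_value I \<sigma> (v, w') < edge_value I (swap_seats \<sigma> p q) (\<sigma> p, w)"
proof -
  let ?\<tau> = "swap_seats \<sigma> p q"
  have p: "p \<in> agents I" and q: "q \<in> agents I" and "p \<noteq> q"
    and envy: "utility I \<sigma> p < utility I ?\<tau> p" "utility I \<sigma> q < utility I ?\<tau> q"
    using bl by (auto simp: exchange_blocking_def envies_def swap_seats_commute[of \<sigma> q p])
  have \<tau>: "?\<tau> p = \<sigma> q" "?\<tau> q = \<sigma> p"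
    using \<open>p \<noteq> q\<close> by (auto simp: swap_seats_def)
  have gain: "utility I \<sigma> q < edge_value I ?\<tau> (\<sigma> p, w)"
    using envy(2) utility_le[OF arrangement_swap_seats[OF arr p q] q] w \<tau>
    by (metis less_le_trans)
  show ?thesis
  proof (cases "neighbours I (\<sigma> q) = {}")
    case False
    then show ?thesis
      using utility_attained[OF arr q] gain by (metis insertCI)
  next
    case True
    \<comment> \<open>Both the old utility of \<open>q\<close> and the new utility of
      \<open>p\<close> are the default 0 of the isolated seat \<open>\<sigma> q\<close>. As
      \<open>p\<close> envies \<open>q\<close>, the old utility of \<open>p\<close> is negative, and
      an old edge at \<open>\<sigma> p\<close> attains it.\<close>
    have "utility I \<sigma> p < utility I \<sigma> q"
      using envy(1) True \<tau> by (simp add: utility_isolated)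
    moreover have "neighbours I (\<sigma> p) \<noteq> {}" using w by blast
    ultimately show ?thesis
      using utility_attained[OF arr p] gain by (metis insertCI less_trans)
  qed
qed

lemma potential_swap_less:
  assumes arr: "arrangement I \<sigma>" and bl: "exchange_blocking I \<sigma> p q"
  shows "potential I (swap_seats \<sigma> p q) < potential I \<sigma>"
proof -
  let ?\<tau> = "swap_seats \<sigma> p q"
  let ?ab = "{\<sigma> p, \<sigma> q}"
  \<comment> \<open>Allowing an exchanged seat in either position makes \<open>A\<close> closed
    under reversal, and a pair outside \<open>A\<close> keeps both of its occupants.\<close>
  define A where "A = {(v, w) \<in> seat_adjacency I. v \<in> ?ab \<or> w \<in> ?ab}"
  have p: "p \<in> agents I" and q: "q \<in> agents I" and "p \<noteq> q"
    using bl by (auto simp: exchange_blocking_def)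
  note arr\<tau> = arrangement_swap_seats[OF arr p q]
  have A_iff: "(v, w) \<in> A \<longleftrightarrow> w \<in> neighbours I v" if "v \<in> ?ab" for v w
    using that seat_of_agent(2)[OF arr] p q by (auto simp: A_def seat_adjacency_def)
  have improve1: "\<exists>z'\<in>A. edge_value I \<sigma> z' < edge_value I ?\<tau> (v, w)"
    if v: "v \<in> ?ab" and w: "(v, w) \<in> A" for v w
  proof -
    have "w \<in> neighbours I v" using v w A_iff by blast
    \<comment> \<open>The case of the seat \<open>\<sigma> q\<close> follows by exchanging the roles
      of \<open>p\<close> and \<open>q\<close>.\<close>
    then have "\<exists>v'\<in>?ab. \<exists>w'\<in>neighbours I v'.
        edge_value I \<sigma> (v', w') < edge_value I ?\<tau> (v, w)"
      using v swapped_edge_improves[OF arr bl, of w]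
        swapped_edge_improves[OF arr, of q p w] bl exchange_blocking_commute[of I \<sigma> p q]
      by (auto simp: swap_seats_commute[of \<sigma> q p])
    then show ?thesis using A_iff by blast
  qed
  have improve: "\<exists>z'\<in>A. edge_value I \<sigma> z' < edge_value I ?\<tau> z" if "z \<in> A" for z
  proof -
    obtain v w where z: "z = (v, w)" "(v, w) \<in> seat_adjacency I" "v \<in> ?ab \<or> w \<in> ?ab"
      using \<open>z \<in> A\<close> by (auto simp: A_def)
    \<comment> \<open>If only the second seat is exchanged, the reversed pair is used; it has the
      same weight in the new arrangement.\<close>
    moreover have "(w, v) \<in> A"
      using z seat_adjacency_sym by (auto simp: A_def)
    ultimately show ?thesis
      using improve1 \<open>z \<in> A\<close> edge_value_sym[OF arr\<tau> z(2)] by metis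
  qed
  have same: "edge_value I ?\<tau> z = edge_value I \<sigma> z" if "z \<in> seat_adjacency I - A" for z
  proof -
    \<comment> \<open>A seat that is not exchanged keeps its occupant.\<close>
    have "inv_into (agents I) ?\<tau> v = inv_into (agents I) \<sigma> v"
      if "v \<in> seats I" "v \<notin> ?ab" for v
    proof -
      let ?x = "inv_into (agents I) \<sigma> v"
      have x: "?x \<in> agents I" "\<sigma> ?x = v" using agent_of_seat[OF arr \<open>v \<in> seats I\<close>] .
      then have "?\<tau> ?x = v" using that(2) by (auto simp: swap_seats_def)
      then show ?thesis using seat_of_agent(1)[OF arr\<tau> x(1)] by simp
    qed
    moreover obtain v w where "z = (v, w)" "v \<in> seats I" "w \<in> seats I" "v \<notin> ?ab" "w \<notin> ?ab"
      using \<open>z \<in> seat_adjacency I - A\<close>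
      by (cases z) (auto simp: A_def seat_adjacency_def neighbours_def)
    ultimately show ?thesis by (simp add: edge_value_def)
  qed
  \<comment> \<open>Were both seats isolated, \<open>p\<close> would have utility 0 before and after
    the swap and could not envy \<open>q\<close>.\<close>
  have "A \<noteq> {}"
  proof
    assume "A = {}"
    then have "neighbours I (\<sigma> p) = {}" "neighbours I (\<sigma> q) = {}" using A_iff by blast+
    moreover have "utility I \<sigma> p < utility I ?\<tau> p" "?\<tau> p = \<sigma> q"
      using bl by (auto simp: exchange_blocking_def envies_def swap_seats_def)
    ultimately show False by (simp add: utility_isolated)
  qed
  moreover have "A \<subseteq> seat_adjacency I" by (auto simp: A_def)
  moreover have "finite (case_prod (valuation I) ` (agents I \<times> agents I))"
    using inst by (simp add: seat_arrangement_instance_def)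
  moreover have "edge_value I \<sigma> ` seat_adjacency I \<subseteq> case_prod (valuation I) ` (agents I \<times> agents I)"
    "edge_value I ?\<tau> ` seat_adjacency I \<subseteq> case_prod (valuation I) ` (agents I \<times> agents I)"
    using edge_value_in_valuations arr arr\<tau> by blast+
  ultimately show ?thesis
    unfolding potential_def Let_def
    using finite_seat_adjacency same improve by (intro rank_power_sum_less[of _ _ A])
qed

section \<open>Termination and existence\<close>

lemma swap_step_arrangement:
  assumes "arrangement I \<sigma>" "swap_step I \<sigma> \<tau>"
  shows "arrangement I \<tau>" "potential I \<tau> < potential I \<sigma>"
  using assms arrangement_swap_seats potential_swap_less
  by (auto simp: swap_step_def exchange_blocking_def)

lemma swap_steps_arrangement:
  assumes "(swap_step I)\<^sup>*\<^sup>* \<sigma> \<tau>" "arrangement I \<sigma>"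
  shows "arrangement I \<tau>"
  using assms by induction (auto intro: swap_step_arrangement)

text \<open>The potentials along such a sequence would descend forever in the natural numbers. Being
  an arrangement is first carried along the sequence, because the decrease holds for
  arrangements.\<close>

lemma no_infinite_swap_sequence:
  assumes "arrangement I (s 0)" and step: "\<And>i::nat. swap_step I (s i) (s (Suc i))"
  shows False
proof -
  have arr: "arrangement I (s i)" for i
    by (induction i) (use assms swap_step_arrangement in auto)
  then have "\<forall>i. (potential I (s (Suc i)), potential I (s i)) \<in> less_than"
    using swap_step_arrangement(2) step by simp
  then show False
    using wf_less_than unfolding wf_iff_no_infinite_down_chain
    by (elim notE exI[of _ "\<lambda>i. potential I (s i)"])
qed

text \<open>Some arrangement exists because agents and seats are equally many; one of least
  potential is stable, since a blocking pair would lead to a smaller potential.\<close>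

lemma exists_exchange_stable: "\<exists>\<sigma>. arrangement I \<sigma> \<and> exchange_stable I \<sigma>"
proof -
  have "\<exists>\<sigma>. arrangement I \<sigma>"
    using inst finite_same_card_bij unfolding seat_arrangement_instance_def arrangement_def
    by metis
  then obtain \<sigma> where "arrangement I \<sigma>"
    and "\<And>\<tau>. arrangement I \<tau> \<Longrightarrow> potential I \<sigma> \<le> potential I \<tau>"
    using ex_has_least_nat[of "arrangement I" _ "potential I"] by metis
  then have "exchange_stable I \<sigma>"
    using swap_step_arrangement unfolding exchange_stable_def swap_step_def
    by (metis not_le)
  then show ?thesis using \<open>arrangement I \<sigma>\<close> by blast
qed

end

theorem theorem1:
  fixes I :: "('a, 'v) seat_instance"
  assumes "seat_arrangement_instance I"
    and "symmetric_preferences I"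
    and "util_type I = W_utility"
  shows "(\<exists>\<sigma>. arrangement I \<sigma> \<and> exchange_stable I \<sigma>) \<and>
    (\<forall>\<sigma>. arrangement I \<sigma> \<longrightarrow>
       (\<nexists>s. s 0 = \<sigma> \<and> (\<forall>i::nat. swap_step I (s i) (s (Suc i)))) \<and>
       (\<forall>\<tau>. (swap_step I)\<^sup>*\<^sup>* \<sigma> \<tau> \<and> (\<nexists>\<tau>'. swap_step I \<tau> \<tau>') \<longrightarrow>
            arrangement I \<tau> \<and> exchange_stable I \<tau>))"
proof (intro conjI allI impI)
  show "\<exists>\<sigma>. arrangement I \<sigma> \<and> exchange_stable I \<sigma>"
    using exists_exchange_stable[OF assms] .
next
  fix \<sigma> assume "arrangement I \<sigma>"
  then show "\<nexists>s. s 0 = \<sigma> \<and> (\<forall>i::nat. swap_step I (s i) (s (Suc i)))"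
    using no_infinite_swap_sequence[OF assms] by blast
next
  fix \<sigma> \<tau>
  assume "arrangement I \<sigma>" "(swap_step I)\<^sup>*\<^sup>* \<sigma> \<tau> \<and> (\<nexists>\<tau>'. swap_step I \<tau> \<tau>')"
  \<comment> \<open>A swap step is available exactly when a blocking pair exists, so a dead end of
    the process is stable.\<close>
  then show "arrangement I \<tau>" "exchange_stable I \<tau>"
    using swap_steps_arrangement[OF assms]
    by (auto simp: exchange_stable_def swap_step_def)
qed

end
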